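(* Consider the rapid-mobile-storage multi-period economic dispatch problem defined in the context, on a radial power network (the network graph is a tree). Let $t\in[T-1]$, let $i,j$ be buses, and let $i\to k_1\to\cdots\to k_p\to j$ be the path in the network from $i$ to $j$. Suppose that, at the optimum, the power flow between node $i$ at time $t$ and node $j$ at time $t+1$ is along the directed path $(i,t)\to(k_1,t)\to\cdots\to(k_p,t)\to(j,t)\to(j,t+1)$ of the time-extended graph, where each edge represents a wire or a stationary storage unit: that is, in period $t$ each line on the path carries positive power in the direction of the path, and a stationary storage unit located at bus $j$ carries positive energy from period $t$ to period $t+1$. Then the marginal value for period $t$ of a mobile storage unit that moves from node $i$ at time $t$ to node $j$ at time $t+1$ equals the sum of the marginal values for period $t$ of the wires on the path from $i$ to $j$ and the marginal value for period $t$ of stationary storage located at bus $j$: $$\mathsf{MV}^{\mathrm{ms}}(t)=\mathsf{MV}^{\mathrm{w}}_{i\to k_1}(t)+\mathsf{MV}^{\mathrm{w}}_{k_1\to k_2}(t)+\cdots+\mathsf{MV}^{\mathrm{w}}_{k_p\to j}(t)+\mathsf{MV}^{\mathrm{ss}}_j(t).$$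
   Context: Notation: $[n]=\{1,\dots,n\}$; $\mathbf 1$ is an all-one vector; $\mathbf e_i$ is the $i$-th elementary vector; $(x)_+=\max\{x,0\}$. Data: a power network with $n$ buses and $m$ lines over periods $t\in[T]$; inelastic loads $\mathbf d(t)\in\mathbb R^n$; generation $\mathbf g(t)\in\mathbb R^n$ (unconstrained) with cost $C(\mathbf g(t))=\sum_{i=1}^n C_i(g_i(t))$, each $C_i$ a strictly convex quadratic. The shift-factor matrix $H\in\mathbb R^{2m\times n}$ has one row per line per direction: for a net injection vector $\mathbf p$ with $\mathbf 1^\top\mathbf p=0$, the entry of $H\mathbf p$ for direction $a\to b$ of line $\{a,b\}$ is the signed power flow from $a$ to $b$ (the row for $b\to a$ is the negative of the row for $a\to b$); on a tree the flows are determined by flow conservation, so a unit injection at $v$ withdrawn at $w$ flows along the unique path from $v$ to $w$. $\overline{\mathbf f}\in\mathbb R^{2m}$ are the line capacities, with nonnegative entries. There are $K$ storage units; unit $k$ is at bus $i_k(t)$ in period $t$ (a stationary storage unit is one with $i_k(t)$ constant in $t$), and $E(t)=[\mathbf e_{i_1(t)},\dots,\mathbf e_{i_K(t)}]\in\mathbb R^{n\times K}$. $u_k(t)$ is the energy charged ($>0$) or discharged ($<0$) by unit $k$ in period $t$; $\mathbf u(t)=(u_1(t),\dots,u_K(t))^\top$, $\mathbf u_k=(u_k(1),\dots,u_k(T))^\top$. The energy carried by unit $k$ from period $t$ to period $t+1$ is its state of charge $\sum_{\tau\le t}u_k(\tau)$. $L\in\mathbb R^{T\times T}$ has $L_{ij}=1$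 if $i\ge j$ and $0$ otherwise; $\overline s_k>0$ are energy capacities. Rapid-storage dispatch problem: minimize $\sum_{t=1}^T C(\mathbf g(t))$ over $\mathbf g,\mathbf u$ subject to (i) $\mathbf 1^\top\mathbf p(t)=0$, (ii) $H\mathbf p(t)\le\overline{\mathbf f}$ for $t\in[T]$, where $\mathbf p(t)=\mathbf g(t)-\mathbf d(t)-E(t)\mathbf u(t)$, and (iii) $\mathbf 0\le L\mathbf u_k\le\overline s_k\mathbf 1$ for $k\in[K]$. Optimal dual variables: $\gamma(t)\in\mathbb R$ for (i), $\bm\beta(t)\in\mathbb R^{2m}_{\ge0}$ for (ii), $\bm\nu_k,\bm\mu_k\in\mathbb R^T_{\ge0}$ for the lower and upper bounds in (iii), with Lagrangian sign convention $\sum_t [C(\mathbf g(t))-\gamma(t)\mathbf 1^\top\mathbf p(t)+\bm\beta(t)^\top(H\mathbf p(t)-\overline{\mathbf f})]+\sum_k[\bm\mu_k^\top(L\mathbf u_k-\overline s_k\mathbf 1)-\bm\nu_k^\top L\mathbf u_k]$. Locational marginal prices: $\bm\lambda(t)=\gamma(t)\mathbf 1-H^\top\bm\beta(t)$. Marginal values for period $t$: for the capacity of a line in direction $a\to b$, $\mathsf{MV}^{\mathrm w}_{a\to b}(t)=\beta_{a\to b}(t)$; for stationary storage at bus $j$, $\mathsf{MV}^{\mathrm{ss}}_j(t)=(\lambda_j(t+1)-\lambda_j(t))_+$; for mobile storage located at bus $i$ at time $t$ and at bus $j$ at time $t+1$, $\mathsf{MV}^{\mathrm{ms}}(t)=(\lambda_j(t+1)-\lambda_i(t))_+$.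 *)

theory Defs
  imports
    "HOL-Analysis.Analysis"
    "Graph_Theory.Pair_Digraph"
    "Graph_Theory.Vertex_Walk"
    "Graph_Theory.Digraph_Component"
begin

text \<open>
  A network is a symmetric digraph: every line gives two arcs, one per direction. A cycle of length
  2 only runs back and forth along one line, so acyclicity refers to cycles of length at least 3.
  (The constant \<open>tree\<close> of Graph\_Theory is about directed cycles and would exclude every line.)
\<close>

definition radial :: "'n pair_pre_digraph \<Rightarrow> bool" where
  "radial G \<longleftrightarrow> pair_graph G \<and> Digraph_Component.connected (with_proj G) \<and>
     \<not> (\<exists>p. pre_digraph.cycle (with_proj G) p \<and> length p \<ge> 3)"

text \<open>
  \<open>H (a, b)\<close> is the row of the shift-factor matrix for direction \<open>a\<close> to \<open>b\<close>. On a tree, the flows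
  caused by a balanced injection are determined by flow conservation. Rows are thereby fixed only
  up to a multiple of the all-one vector (the choice of a slack bus), and no choice is imposed.
\<close>

definition shift_factors ::
  "'n::finite pair_pre_digraph \<Rightarrow> ('n \<times> 'n \<Rightarrow> real^'n) \<Rightarrow> bool" where
  "shift_factors G H \<longleftrightarrow>
     (\<forall>(a, b) \<in> parcs G. H (b, a) = - H (a, b)) \<and>
     (\<forall>p. (\<Sum>v\<in>UNIV. p $ v) = 0 \<longrightarrow>
        (\<forall>v. (\<Sum>w | (v, w) \<in> parcs G. H (v, w) \<bullet> p) = p $ v))"

text \<open>Functions of a period are only relevant on \<open>{1..horizon D}\<close>, functions of a pair of buses
  only on the arcs of the network.\<close>

record ('n::finite, 'k::finite) dispatch =
  network :: "'n pair_pre_digraph"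
  shift_factor :: "'n \<times> 'n \<Rightarrow> real^'n"
  line_cap :: "'n \<times> 'n \<Rightarrow> real"
  horizon :: nat
  demand :: "nat \<Rightarrow> real^'n"
  gen_cost :: "'n \<Rightarrow> real \<Rightarrow> real"
  unit_bus :: "'k \<Rightarrow> nat \<Rightarrow> 'n"
  energy_cap :: "'k \<Rightarrow> real"

locale radial_dispatch =
  fixes D :: "('n::finite, 'k::finite) dispatch"
  assumes buses: "pverts (network D) = UNIV"
    and radial: "radial (network D)"
    and shift_factors: "shift_factors (network D) (shift_factor D)"
    and line_cap_nonneg: "l \<in> parcs (network D) \<Longrightarrow> line_cap D l \<ge> 0"
    and strictly_convex_quadratic:
      "\<exists>a b c. a > 0 \<and> (\<forall>x. gen_cost D v x = a * x\<^sup>2 + b * x + c)"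
    and energy_cap_pos: "energy_cap D k > 0"

definition unit_matrix :: "('n::finite, 'k::finite) dispatch \<Rightarrow> nat \<Rightarrow> real^'k^'n" where
  "unit_matrix D t = (\<chi> v k. axis (unit_bus D k t) 1 $ v)"

definition net_injection ::
  "('n::finite, 'k::finite) dispatch \<Rightarrow> (nat \<Rightarrow> real^'n) \<Rightarrow> (nat \<Rightarrow> real^'k) \<Rightarrow> nat \<Rightarrow> real^'n" where
  "net_injection D g u t = g t - demand D t - unit_matrix D t *v u t"

definition flow ::
  "('n::finite, 'k::finite) dispatch \<Rightarrow> (nat \<Rightarrow> real^'n) \<Rightarrow> (nat \<Rightarrow> real^'k) \<Rightarrow> nat \<Rightarrow> 'n \<times> 'n \<Rightarrow> real" where
  "flow D g u t l = shift_factor D l \<bullet> net_injection D g u t"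

definition soc :: "(nat \<Rightarrow> real^'k::finite) \<Rightarrow> 'k \<Rightarrow> nat \<Rightarrow> real" where
  "soc u k t = (\<Sum>\<tau>=1..t. u \<tau> $ k)"

definition total_cost ::
  "('n::finite, 'k::finite) dispatch \<Rightarrow> (nat \<Rightarrow> real^'n) \<Rightarrow> real" where
  "total_cost D g = (\<Sum>t=1..horizon D. \<Sum>v\<in>UNIV. gen_cost D v (g t $ v))"

definition primal_feasible ::
  "('n::finite, 'k::finite) dispatch \<Rightarrow> (nat \<Rightarrow> real^'n) \<Rightarrow> (nat \<Rightarrow> real^'k) \<Rightarrow> bool" where
  "primal_feasible D g u \<longleftrightarrow>
     (\<forall>t\<in>{1..horizon D}. (\<Sum>v\<in>UNIV. net_injection D g u t $ v) = 0) \<and>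
     (\<forall>t\<in>{1..horizon D}. \<forall>l\<in>parcs (network D). flow D g u t l \<le> line_cap D l) \<and>
     (\<forall>k. \<forall>t\<in>{1..horizon D}. 0 \<le> soc u k t \<and> soc u k t \<le> energy_cap D k)"

definition primal_optimal ::
  "('n::finite, 'k::finite) dispatch \<Rightarrow> (nat \<Rightarrow> real^'n) \<Rightarrow> (nat \<Rightarrow> real^'k) \<Rightarrow> bool" where
  "primal_optimal D g u \<longleftrightarrow> primal_feasible D g u \<and>
     (\<forall>g' u'. primal_feasible D g' u' \<longrightarrow> total_cost D g \<le> total_cost D g')"

record ('n, 'k) dual_vars =
  gamma :: "nat \<Rightarrow> real"
  beta :: "nat \<Rightarrow> 'n \<times> 'n \<Rightarrow> real"
  nu :: "'k \<Rightarrow> nat \<Rightarrow> real"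
  mu :: "'k \<Rightarrow> nat \<Rightarrow> real"

definition dual_feasible ::
  "('n::finite, 'k::finite) dispatch \<Rightarrow> ('n, 'k) dual_vars \<Rightarrow> bool" where
  "dual_feasible D y \<longleftrightarrow>
     (\<forall>t\<in>{1..horizon D}. \<forall>l\<in>parcs (network D). beta y t l \<ge> 0) \<and>
     (\<forall>k. \<forall>t\<in>{1..horizon D}. nu y k t \<ge> 0 \<and> mu y k t \<ge> 0)"

definition lagrangian ::
  "('n::finite, 'k::finite) dispatch \<Rightarrow> (nat \<Rightarrow> real^'n) \<Rightarrow> (nat \<Rightarrow> real^'k) \<Rightarrow>
   ('n, 'k) dual_vars \<Rightarrow> real" where
  "lagrangian D g u y =
     (\<Sum>t=1..horizon D.
        (\<Sum>v\<in>UNIV. gen_cost D v (g t $ v))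
        - gamma y t * (\<Sum>v\<in>UNIV. net_injection D g u t $ v)
        + (\<Sum>l\<in>parcs (network D). beta y t l * (flow D g u t l - line_cap D l)))
     + (\<Sum>k\<in>UNIV.
          (\<Sum>t=1..horizon D. mu y k t * (soc u k t - energy_cap D k))
          - (\<Sum>t=1..horizon D. nu y k t * soc u k t))"

text \<open>The Lagrangian may be unbounded below in \<open>g\<close> and \<open>u\<close>, hence the extended reals.\<close>

definition dual_function ::
  "('n::finite, 'k::finite) dispatch \<Rightarrow> ('n, 'k) dual_vars \<Rightarrow> ereal" where
  "dual_function D y = (INF (g, u) \<in> UNIV. ereal (lagrangian D g u y))"

definition dual_optimal ::
  "('n::finite, 'k::finite) dispatch \<Rightarrow> ('n, 'k) dual_vars \<Rightarrow> bool" where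
  "dual_optimal D y \<longleftrightarrow> dual_feasible D y \<and>
     (\<forall>y'. dual_feasible D y' \<longrightarrow> dual_function D y' \<le> dual_function D y)"

definition lmp ::
  "('n::finite, 'k::finite) dispatch \<Rightarrow> ('n, 'k) dual_vars \<Rightarrow> nat \<Rightarrow> real^'n" where
  "lmp D y t = gamma y t *\<^sub>R 1 - (\<Sum>l\<in>parcs (network D). beta y t l *\<^sub>R shift_factor D l)"

definition mv_wire :: "('n, 'k) dual_vars \<Rightarrow> 'n \<times> 'n \<Rightarrow> nat \<Rightarrow> real" where
  "mv_wire y l t = beta y t l"

definition mv_stationary ::
  "('n::finite, 'k::finite) dispatch \<Rightarrow> ('n, 'k) dual_vars \<Rightarrow> 'n \<Rightarrow> nat \<Rightarrow> real" where
  "mv_stationary D y j t = max (lmp D y (t + 1) $ j - lmp D y t $ j) 0"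

definition mv_mobile ::
  "('n::finite, 'k::finite) dispatch \<Rightarrow> ('n, 'k) dual_vars \<Rightarrow> 'n \<Rightarrow> 'n \<Rightarrow> nat \<Rightarrow> real" where
  "mv_mobile D y i j t = max (lmp D y (t + 1) $ j - lmp D y t $ i) 0"

definition stationary_at :: "('n::finite, 'k::finite) dispatch \<Rightarrow> 'k \<Rightarrow> 'n \<Rightarrow> bool" where
  "stationary_at D k j \<longleftrightarrow> (\<forall>\<tau>\<in>{1..horizon D}. unit_bus D k \<tau> = j)"

end

theory Submission
  imports Defs
begin

text \<open>
  The constraints are affine and the cost is a convex quadratic, so Farkas' lemma gives strong
  duality without a constraint qualification (capacities may be zero). Hence \<open>(g, u)\<close> minimises the
  Lagrangian of every dual optimum \<open>y\<close>, and complementary slackness holds. Shifting energy of the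
  stationary unit at \<open>j\<close> between periods \<open>t\<close> and \<open>t + 1\<close> shows
  \<open>\<lambda>\<^sub>j(t + 1) - \<lambda>\<^sub>j(t) = \<mu>(t) - \<nu>(t)\<close>, and \<open>\<nu>(t) = 0\<close> because the state of charge is positive. On a tree
  an injection at \<open>a\<close> withdrawn at a neighbour \<open>b\<close> uses only their line, so
  \<open>\<lambda>\<^sub>b(t) - \<lambda>\<^sub>a(t) = \<beta>(a, b) - \<beta>(b, a)\<close>, and \<open>\<beta>(b, a) = 0\<close> if the flow is positive from \<open>a\<close> to \<open>b\<close>.
  Summing along the path, all differences are nonnegative and the positive parts add up.
\<close>

section \<open>Lagrange multipliers for quadratic programs\<close>

text \<open>Points are functions, so the vector operations are written pointwise;
  \<open>f d - f (\<lambda>_. 0)\<close> is the linear part of \<open>f\<close> at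
  \<open>d\<close>.\<close>

definition affine_form :: "(('i \<Rightarrow> 'v::real_vector) \<Rightarrow> real) \<Rightarrow> bool" where
  "affine_form f \<longleftrightarrow>
     (\<forall>x d s. f (\<lambda>i. x i + s *\<^sub>R d i) = f x + s * (f d - f (\<lambda>_. 0)))"

definition linear_form :: "(('i \<Rightarrow> 'v::real_vector) \<Rightarrow> real) \<Rightarrow> bool" where
  "linear_form f \<longleftrightarrow> (\<forall>x d s. f (\<lambda>i. x i + s *\<^sub>R d i) = f x + s * f d)"

lemma linear_form_step: "linear_form f \<Longrightarrow> f (\<lambda>i. x i + s *\<^sub>R d i) = f x + s * f d"
  by (simp add: linear_form_def)

lemma linear_form_zero: "linear_form f \<Longrightarrow> f (\<lambda>_. 0) = 0"
  using linear_form_step[of f "\<lambda>_. 0" 1 "\<lambda>_. 0"] by simp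

lemma linear_form_scale: "linear_form f \<Longrightarrow> f (\<lambda>i. s *\<^sub>R x i) = s * f x"
  using linear_form_step[of f "\<lambda>_. 0" s x] by (simp add: linear_form_zero)

lemma linear_form_uminus: "linear_form f \<Longrightarrow> linear_form (\<lambda>x. - f x)"
  by (simp add: linear_form_def)

lemma affine_form_step:
  "affine_form f \<Longrightarrow> f (\<lambda>i. x i + s *\<^sub>R d i) = f x + s * (f d - f (\<lambda>_. 0))"
  by (simp add: affine_form_def)

lemma affine_form_slope: "affine_form f \<Longrightarrow> linear_form (\<lambda>d. f d - f (\<lambda>_. 0))"
  by (simp add: affine_form_def linear_form_def)

text \<open>For \<open>r = a x0\<close>, the argument of \<open>b\<close> is the projection of
  \<open>x\<close> onto the kernel of \<open>a\<close> along \<open>x0\<close>.\<close>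

lemma linear_form_compose_elimination:
  fixes a b :: "('i \<Rightarrow> 'v::real_vector) \<Rightarrow> real"
  assumes "linear_form a" "linear_form b"
  shows "linear_form (\<lambda>x. b (\<lambda>i. x i + (- a x / r) *\<^sub>R x0 i))"
proof -
  note step = linear_form_step[OF assms(1)] linear_form_step[OF assms(2)]
  show ?thesis
    unfolding linear_form_def
    by (simp only: step) (simp add: add_divide_distrib diff_divide_distrib algebra_simps)
qed

text \<open>Bartl's induction: if dropping constraint \<open>c\<close> breaks the implication, a witness \<open>x0\<close> of the
  failure spans a complement of the kernel of \<open>a c\<close>; the induction hypothesis is applied to the
  forms composed with the projection onto that kernel along \<open>x0\<close>.\<close>

lemma farkas:
  fixes a :: "'c \<Rightarrow> ('i \<Rightarrow> 'v::real_vector) \<Rightarrow> real"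
  assumes "finite C" "\<And>c. c \<in> C \<Longrightarrow> linear_form (a c)" "linear_form b"
    and "\<And>x. (\<forall>c\<in>C. a c x \<le> 0 \<and> (c \<in> E \<longrightarrow> a c x = 0)) \<Longrightarrow> b x \<le> 0"
  shows "\<exists>l. (\<forall>c\<in>C - E. 0 \<le> l c) \<and> (\<forall>x. b x = (\<Sum>c\<in>C. l c * a c x))"
  using assms
proof (induction C arbitrary: a b rule: finite_induct)
  case empty
  \<comment> \<open>Without constraints, the hypothesis applies both to \<open>x\<close> and to its
    negative.\<close>
  have "b x = 0" for x
    using empty.prems(3)[of x] empty.prems(3)[of "\<lambda>i. (-1) *\<^sub>R x i"] linear_form_scale[OF empty.prems(2), of "-1" x]
    by simp
  then show ?case by simp
next
  case (insert d C)
  note lin = insert.prems(1) and linb = insert.prems(2)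
  show ?case
  proof (cases "\<forall>x. (\<forall>c\<in>C. a c x \<le> 0 \<and> (c \<in> E \<longrightarrow> a c x = 0)) \<longrightarrow> b x \<le> 0")
    case True
    then obtain l where l: "\<forall>c\<in>C - E. 0 \<le> l c" "\<forall>x. b x = (\<Sum>c\<in>C. l c * a c x)"
      using insert.IH[of a b] lin linb by blast
    have "(\<Sum>c\<in>insert d C. (l(d := 0)) c * a c x) = (\<Sum>c\<in>C. l c * a c x)" for x
      using insert.hyps by (auto intro!: sum.cong)
    with l show ?thesis
      by (intro exI[of _ "l(d := 0)"]) auto
  next
    case False
    then obtain x0 where x0: "\<And>c. c \<in> C \<Longrightarrow> a c x0 \<le> 0 \<and> (c \<in> E \<longrightarrow> a c x0 = 0)" "b x0 > 0"
      by force
    define r where "r = a d x0"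
    \<comment> \<open>Otherwise \<open>x0\<close> would satisfy constraint \<open>d\<close> as well,
      forcing \<open>b x0 \<le> 0\<close>.\<close>
    have r: "r \<noteq> 0" "d \<notin> E \<Longrightarrow> r > 0"
      using insert.prems(3)[of x0] x0 by (force simp: r_def)+
    define P where "P x = (\<lambda>i. x i + (- a d x / r) *\<^sub>R x0 i)" for x
    have P: "f (P x) = f x - a d x / r * f x0" if "linear_form f" for f x
      unfolding P_def by (subst linear_form_step[OF that]) simp
    have aP: "a d (P x) = 0" for x
      using P[of "a d"] lin r by (simp add: r_def)
    have linP: "linear_form (\<lambda>x. f (P x))" if "linear_form f" for f
      using linear_form_compose_elimination[OF lin[of d] that, of r x0] by (simp add: P_def)
    have "\<exists>l. (\<forall>c\<in>C - E. 0 \<le> l c) \<and> (\<forall>x. b (P x) = (\<Sum>c\<in>C. l c * a c (P x)))"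
    proof (rule insert.IH)
      fix x assume "\<forall>c\<in>C. a c (P x) \<le> 0 \<and> (c \<in> E \<longrightarrow> a c (P x) = 0)"
      \<comment> \<open>Projected points satisfy constraint \<open>d\<close> with equality, so only
        the constraints in \<open>C\<close> remain to be assumed.\<close>
      then show "b (P x) \<le> 0"
        by (intro insert.prems(3)) (auto simp: aP)
    qed (use lin linb linP in auto)
    then obtain l where l: "\<forall>c\<in>C - E. 0 \<le> l c" "\<And>x. b (P x) = (\<Sum>c\<in>C. l c * a c (P x))"
      by blast
    \<comment> \<open>The value forced by evaluating the desired identity at
      \<open>x0\<close>.\<close>
    define m where "m = (b x0 - (\<Sum>c\<in>C. l c * a c x0)) / r"
    have "l c * a c x0 \<le> 0" if "c \<in> C" for c
      using x0(1)[OF that] l(1) that by (cases "c \<in> E") (auto simp: mult_nonneg_nonpos)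
    then have "(\<Sum>c\<in>C. l c * a c x0) \<le> 0"
      by (rule sum_nonpos)
    then have m: "d \<notin> E \<Longrightarrow> 0 \<le> m"
      using r x0(2) by (auto simp: m_def)
    have "b x = m * a d x + (\<Sum>c\<in>C. l c * a c x)" for x
    proof -
      have "b x - a d x / r * b x0 = (\<Sum>c\<in>C. l c * (a c x - a d x / r * a c x0))"
        using l(2)[of x] P[OF linb] by (simp add: P lin)
      also have "\<dots> = (\<Sum>c\<in>C. l c * a c x) - a d x / r * (\<Sum>c\<in>C. l c * a c x0)"
        by (simp add: sum_subtractf sum_distrib_left algebra_simps)
      finally show ?thesis
        by (simp add: m_def diff_divide_distrib algebra_simps)
    qed
    moreover have "(\<Sum>c\<in>insert d C. (l(d := m)) c * a c x) = m * a d x + (\<Sum>c\<in>C. l c * a c x)" for x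
      using insert.hyps by (auto intro!: sum.cong)
    ultimately show ?thesis
      using l(1) m by (intro exI[of _ "l(d := m)"]) auto
  qed
qed

text \<open>At a minimiser, no direction that respects the active constraints decreases
  \<open>J\<close> to first order, so Farkas' lemma writes \<open>- b\<close> as a combination of
  their slopes. As \<open>q\<close> is nonnegative, this first-order identity becomes a global lower
  bound on the Lagrangian.\<close>

lemma lagrange_multipliers:
  fixes F :: "'c \<Rightarrow> ('i \<Rightarrow> 'v::real_vector) \<Rightarrow> real"
  assumes fin: "finite C" and aff: "\<And>c. c \<in> C \<Longrightarrow> affine_form (F c)"
    and feas: "\<And>c. c \<in> C \<Longrightarrow> F c x0 \<le> 0 \<and> (c \<in> E \<longrightarrow> F c x0 = 0)"
    and opt: "\<And>x. (\<forall>c\<in>C. F c x \<le> 0 \<and> (c \<in> E \<longrightarrow> F c x = 0)) \<Longrightarrow> J x0 \<le> J x"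
    and lin: "linear_form b"
    and J: "\<And>d s. J (\<lambda>i. x0 i + s *\<^sub>R d i) = J x0 + s * b d + s\<^sup>2 * q d"
    and q: "\<And>d. q d \<ge> 0"
  shows "\<exists>l. (\<forall>c\<in>C - E. 0 \<le> l c) \<and> (\<forall>x. J x0 \<le> J x + (\<Sum>c\<in>C. l c * F c x))"
proof -
  define A where "A = {c \<in> C. F c x0 = 0}"
  define a where "a c d = F c d - F c (\<lambda>_. 0)" for c d
  have step: "F c (\<lambda>i. x0 i + s *\<^sub>R d i) = F c x0 + s * a c d" if "c \<in> C" for c s d
    using affine_form_step[OF aff[OF that]] by (simp add: a_def)
  have "\<exists>l. (\<forall>c\<in>A - E. 0 \<le> l c) \<and> (\<forall>x. - b x = (\<Sum>c\<in>A. l c * a c x))"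
  proof (rule farkas)
    show "finite A" using fin by (simp add: A_def)
    show "linear_form (a c)" if "c \<in> A" for c
      using affine_form_slope[OF aff[of c]] that by (simp add: A_def a_def[abs_def])
    show "linear_form (\<lambda>x. - b x)" using lin by (rule linear_form_uminus)
    fix d assume d: "\<forall>c\<in>A. a c d \<le> 0 \<and> (c \<in> E \<longrightarrow> a c d = 0)"
    show "- b d \<le> 0"
    proof (rule ccontr)
      assume "\<not> - b d \<le> 0"
      then have neg: "b d < 0" by simp
      \<comment> \<open>Active constraints do not increase along \<open>d\<close>; inactive ones
        stay negative for small \<open>s\<close> by continuity.\<close>
      have ev: "eventually (\<lambda>s. F c x0 + s * a c d \<le> 0) (at_right 0)" if "c \<in> C" for c
      proof (cases "c \<in> A")
        case True
        then show ?thesis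
          using d by (intro eventually_at_rightI[of 0 1]) (auto simp: A_def mult_nonneg_nonpos)
      next
        case False
        have "((\<lambda>s. F c x0 + s * a c d) \<longlongrightarrow> F c x0 + 0 * a c d) (at_right 0)"
          by (intro tendsto_intros)
        moreover have "F c x0 < 0"
          using feas[OF that] False that by (auto simp: A_def)
        ultimately have "eventually (\<lambda>s. F c x0 + s * a c d < 0) (at_right 0)"
          using order_tendstoD(2) by fastforce
        then show ?thesis by eventually_elim simp
      qed
      \<comment> \<open>This is the change of \<open>J\<close> divided by the step size
        \<open>s\<close>, so a short step along \<open>d\<close> is a strict improvement.\<close>
      have "((\<lambda>s. b d + s * q d) \<longlongrightarrow> b d + 0 * q d) (at_right 0)"
        by (intro tendsto_intros)
      then have "eventually (\<lambda>s. b d + s * q d < 0) (at_right 0)"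
        using order_tendstoD(2) neg by fastforce
      moreover have "eventually (\<lambda>s. \<forall>c\<in>C. F c x0 + s * a c d \<le> 0) (at_right 0)"
        using ev fin by (simp add: eventually_ball_finite_distrib)
      moreover have "eventually (\<lambda>s::real. 0 < s) (at_right 0)"
        by (simp add: eventually_at_right_less)
      ultimately have "eventually (\<lambda>s. b d + s * q d < 0 \<and> (\<forall>c\<in>C. F c x0 + s * a c d \<le> 0) \<and> 0 < s) (at_right 0)"
        by eventually_elim simp
      then obtain s where s: "b d + s * q d < 0" "\<forall>c\<in>C. F c x0 + s * a c d \<le> 0" "0 < s"
        using eventually_happens' trivial_limit_at_right_real by blast
      have "J x0 \<le> J (\<lambda>i. x0 i + s *\<^sub>R d i)"
        using s(2) feas d by (intro opt) (auto simp: step A_def)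
      then have "0 \<le> s * (b d + s * q d)"
        by (simp add: J power2_eq_square algebra_simps)
      with s show False
        by (simp add: zero_le_mult_iff)
    qed
  qed
  then obtain l where l: "\<forall>c\<in>A - E. 0 \<le> l c" "\<And>x. - b x = (\<Sum>c\<in>A. l c * a c x)"
    by blast
  \<comment> \<open>Inactive constraints get multiplier 0, which is complementary slackness at
    \<open>x0\<close>.\<close>
  define m where "m c = (if c \<in> A then l c else 0)" for c
  have "J x0 \<le> J x + (\<Sum>c\<in>C. m c * F c x)" for x
  proof -
    \<comment> \<open>A unit step along \<open>d\<close> leads from \<open>x0\<close> to
      \<open>x\<close>; the linear terms then cancel and only \<open>q d\<close> is left.\<close>
    define d where "d i = x i - x0 i" for i
    have x: "x = (\<lambda>i. x0 i + 1 *\<^sub>R d i)"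
      by (simp add: d_def)
    have "(\<Sum>c\<in>C. m c * F c x) = (\<Sum>c\<in>A. m c * F c x)"
      using fin by (intro sum.mono_neutral_right) (auto simp: m_def A_def)
    also have "\<dots> = (\<Sum>c\<in>A. l c * a c d)"
    proof (rule sum.cong)
      fix c assume "c \<in> A"
      then show "m c * F c x = l c * a c d"
        using step[of c 1 d] unfolding x by (simp add: m_def A_def)
    qed simp
    also have "\<dots> = - b d"
      using l(2) by simp
    finally have "(\<Sum>c\<in>C. m c * F c x) = - b d" .
    moreover have "J x = J x0 + b d + q d"
      using J[of 1 d] unfolding x[symmetric] by simp
    ultimately show ?thesis
      using q[of d] by simp
  qed
  moreover have "\<forall>c\<in>C - E. 0 \<le> m c"
    using l(1) by (auto simp: m_def)
  ultimately show ?thesis by blast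
qed

section \<open>Circulations on trees\<close>

lemma radial_symmetric:
  assumes "radial G" "(a, b) \<in> parcs G"
  shows "(b, a) \<in> parcs G"
proof -
  interpret G: pair_graph G
    using assms by (simp add: radial_def)
  show ?thesis
    using G.pair_sym_arcs assms by (auto simp: symmetric_def sym_def)
qed

text \<open>The arcs with positive flow form an acyclic relation on a tree, but conservation lets
  every such arc be continued by another one. This is impossible on finitely many vertices.\<close>

lemma circulation_on_tree_zero:
  fixes f :: "'n::finite \<times> 'n \<Rightarrow> real"
  assumes tree: "radial G"
    and anti: "\<And>a b. (a, b) \<in> parcs G \<Longrightarrow> f (b, a) = - f (a, b)"
    and cons: "\<And>v. (\<Sum>w | (v, w) \<in> parcs G. f (v, w)) = 0"
    and arc: "(a, b) \<in> parcs G"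
  shows "f (a, b) = 0"
proof (rule ccontr)
  assume nz: "f (a, b) \<noteq> 0"
  interpret G: pair_graph G
    using tree by (simp add: radial_def)
  note sym = radial_symmetric[OF tree]
  define R where "R = {l \<in> parcs G. f l > 0}"
  have R_anti: "(w, v) \<notin> R" if "(v, w) \<in> R" for v w
    using that anti[of v w] by (auto simp: R_def)
  have R_irrefl: "(v, v) \<notin> R" for v
    using R_anti by blast
  define G' where "G' = \<lparr>pverts = pverts G, parcs = R\<rparr>"
  interpret G': pair_wf_digraph G'
    by unfold_locales (auto simp: G'_def R_def G.arc_fst_in_verts G.arc_snd_in_verts)
  have "acyclic R"
    unfolding acyclic_def
  proof (intro allI notI)
    fix v assume "(v, v) \<in> R\<^sup>+"
    then obtain p where "pre_digraph.awalk (with_proj G') v p v" "p \<noteq> []"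
      using G'.reachable1_awalk[of v v] by (auto simp: G'_def)
    then have "G'.closed_w p"
      by (auto simp: G'.closed_w_def)
    then obtain c where c: "pre_digraph.cycle (with_proj G') c"
      using G'.closed_w_imp_cycle by blast
    then obtain w where w: "pcas w c w" "set c \<subseteq> R" "c \<noteq> []" "distinct (tl (pawalk_verts w c))" "w \<in> pverts G"
      unfolding G'.cycle_def G'.awalk_def by (auto simp: G'_def)
    \<comment> \<open>\<open>radial\<close> only excludes cycles of length at least 3; the shorter
      ones contradict antisymmetry of the flow.\<close>
    have "length c \<noteq> 1" "length c \<noteq> 2"
      using w by (auto simp: length_Suc_conv numeral_2_eq_2 R_irrefl dest: R_anti)
    moreover have "length c \<noteq> 0"
      using w by simp
    ultimately have "length c \<ge> 3"
      by linarith
    moreover have "pre_digraph.cycle (with_proj G) c"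
      unfolding G.cycle_def G.awalk_def using w by (auto simp: R_def)
    ultimately show False
      using tree by (auto simp: radial_def)
  qed
  then have wf: "wf (R\<inverse>)"
    by (intro finite_acyclic_wf_converse) simp_all
  \<comment> \<open>Otherwise no arc leaving \<open>v\<close> carries positive flow, while the one
    back to \<open>u\<close> carries negative flow, so the net outflow is negative.\<close>
  have next_arc: "\<exists>w. (v, w) \<in> R" if "(u, v) \<in> R" for u v
  proof (rule ccontr)
    assume "\<not> (\<exists>w. (v, w) \<in> R)"
    then have "f (v, w) \<le> 0" if "(v, w) \<in> parcs G" for w
      using that by (force simp: R_def)
    moreover have "f (v, u) < 0" "(v, u) \<in> parcs G"
      using that anti[of u v] sym by (auto simp: R_def)
    ultimately have "(\<Sum>w | (v, w) \<in> parcs G. f (v, w)) < (\<Sum>w | (v, w) \<in> parcs G. 0)"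
      by (intro sum_strict_mono_ex1) auto
    with cons[of v] show False by simp
  qed
  have "(a, b) \<in> R \<or> (b, a) \<in> R"
    using nz arc anti[OF arc] sym[OF arc] by (auto simp: R_def)
  then have "\<exists>v. v \<in> Range R"
    by blast
  \<comment> \<open>Every successor of \<open>v\<close> would lie in \<open>Range R\<close>, so this
    choice of \<open>v\<close> has none.\<close>
  then obtain v where "v \<in> Range R" "\<And>w. (v, w) \<in> R \<Longrightarrow> w \<notin> Range R"
    using wfE_min[OF wf, of _ "Range R"] by (metis converse_iff)
  then show False
    using next_arc by (metis Range_iff)
qed

text \<open>The difference of entries is the flow caused by injecting one unit at \<open>a\<close>
  and withdrawing it at \<open>b\<close>. The unit flow on the single line \<open>(a, b)\<close> has
  the same net injections, so the two differ by a circulation. Adding a multiple of the all-one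
  vector to a row leaves the difference unchanged.\<close>

lemma shift_factors_adjacent:
  fixes H :: "'n::finite \<times> 'n \<Rightarrow> real^'n"
  assumes tree: "radial G" and H: "shift_factors G H"
    and arc: "(a, b) \<in> parcs G" and l: "l \<in> parcs G"
  shows "H l $ a - H l $ b = of_bool (l = (a, b)) - of_bool (l = (b, a))"
proof -
  have sym: "(b, a) \<in> parcs G"
    using tree arc by (rule radial_symmetric)
  define p :: "real^'n" where "p = axis a 1 - axis b 1"
  define e :: "'n \<times> 'n \<Rightarrow> real"
    where "e l = of_bool (l = (a, b)) - of_bool (l = (b, a))" for l
  have Hp: "H l \<bullet> p = H l $ a - H l $ b" for l
    by (simp add: p_def inner_diff_right inner_axis)
  have p0: "(\<Sum>v\<in>UNIV. p $ v) = 0"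
    by (simp add: p_def axis_def sum_subtractf)
  obtain c d where cd: "l = (c, d)" by force
  have "H (c, d) \<bullet> p - e (c, d) = 0"
  proof (rule circulation_on_tree_zero[OF tree, of "\<lambda>l. H l \<bullet> p - e l"])
    show "(c, d) \<in> parcs G" using l cd by simp
    show "H (w, v) \<bullet> p - e (w, v) = - (H (v, w) \<bullet> p - e (v, w))" if "(v, w) \<in> parcs G" for v w
    proof -
      have "H (w, v) = - H (v, w)"
        using H that unfolding shift_factors_def by blast
      then show ?thesis
        by (simp add: e_def conj_commute)
    qed
    fix v
    have "(\<Sum>w | (v, w) \<in> parcs G. of_bool ((v, w) = (x, y))) = (of_bool (v = x) :: real)"
      if "(x, y) \<in> parcs G" for x y
      using that by (cases "v = x") (simp_all add: of_bool_def)
    then have "(\<Sum>w | (v, w) \<in> parcs G. e (v, w)) = p $ v"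
      using arc sym by (simp add: e_def sum_subtractf p_def axis_def)
    moreover have "(\<Sum>w | (v, w) \<in> parcs G. H (v, w) \<bullet> p) = p $ v"
      using H p0 by (simp add: shift_factors_def)
    ultimately show "(\<Sum>w | (v, w) \<in> parcs G. H (v, w) \<bullet> p - e (v, w)) = 0"
      by (simp add: sum_subtractf)
  qed
  then show ?thesis
    by (simp add: Hp cd e_def)
qed

section \<open>Strong duality for the dispatch problem\<close>

text \<open>One index type for all four families, as the general multiplier lemma requires.\<close>

datatype ('n, 'k) dispatch_constraint =
  Balance nat | Line nat "'n \<times> 'n" | Lower 'k nat | Upper 'k nat

primrec violation :: "('n, 'k) dispatch_constraint \<Rightarrow>
    ('n::finite, 'k::finite) dispatch \<Rightarrow> (nat \<Rightarrow> (real^'n) \<times> (real^'k)) \<Rightarrow> real" where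
  "violation (Balance t) D x = (\<Sum>v\<in>UNIV. net_injection D (fst \<circ> x) (snd \<circ> x) t $ v)"
| "violation (Line t l) D x = flow D (fst \<circ> x) (snd \<circ> x) t l - line_cap D l"
| "violation (Lower k t) D x = - soc (snd \<circ> x) k t"
| "violation (Upper k t) D x = soc (snd \<circ> x) k t - energy_cap D k"

text \<open>The minus sign reflects that \<open>gamma\<close> enters the Lagrangian
  negatively.\<close>

primrec multiplier :: "('n, 'k) dispatch_constraint \<Rightarrow> ('n, 'k) dual_vars \<Rightarrow> real" where
  "multiplier (Balance t) y = - gamma y t"
| "multiplier (Line t l) y = beta y t l"
| "multiplier (Lower k t) y = nu y k t"
| "multiplier (Upper k t) y = mu y k t"

definition constraints ::
  "('n::finite, 'k::finite) dispatch \<Rightarrow> ('n, 'k) dispatch_constraint set" where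
  "constraints D = Balance ` {1..horizon D} \<union>
     case_prod Line ` ({1..horizon D} \<times> parcs (network D)) \<union>
     case_prod Lower ` (UNIV \<times> {1..horizon D}) \<union>
     case_prod Upper ` (UNIV \<times> {1..horizon D})"

lemma finite_constraints: "finite (constraints D)"
  by (simp add: constraints_def)

lemma constraints_iff [simp]:
  "Balance t \<in> constraints D \<longleftrightarrow> t \<in> {1..horizon D}"
  "Line t l \<in> constraints D \<longleftrightarrow> t \<in> {1..horizon D} \<and> l \<in> parcs (network D)"
  "Lower k t \<in> constraints D \<longleftrightarrow> t \<in> {1..horizon D}"
  "Upper k t \<in> constraints D \<longleftrightarrow> t \<in> {1..horizon D}"
  by (auto simp: constraints_def)

text \<open>The weight \<open>h\<close> is arbitrary because the lemma serves both the violations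
  themselves and their slopes along a direction.\<close>

lemma sum_constraints:
  "(\<Sum>c\<in>constraints D. multiplier c y * h c) =
     (\<Sum>t=1..horizon D. (\<Sum>l\<in>parcs (network D). beta y t l * h (Line t l)) - gamma y t * h (Balance t))
     + (\<Sum>k\<in>UNIV. \<Sum>t=1..horizon D. mu y k t * h (Upper k t) + nu y k t * h (Lower k t))"
proof -
  have "(\<Sum>c\<in>constraints D. multiplier c y * h c) =
     (\<Sum>c\<in>Balance ` {1..horizon D}. multiplier c y * h c) +
     (\<Sum>c\<in>case_prod Line ` ({1..horizon D} \<times> parcs (network D)). multiplier c y * h c) +
     (\<Sum>c\<in>case_prod Lower ` (UNIV \<times> {1..horizon D}). multiplier c y * h c) +
     (\<Sum>c\<in>case_prod Upper ` (UNIV \<times> {1..horizon D}). multiplier c y * h c)"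
    unfolding constraints_def by (subst sum.union_disjoint, auto)+
  also have "(\<Sum>c\<in>Balance ` {1..horizon D}. multiplier c y * h c) =
      (\<Sum>t=1..horizon D. - gamma y t * h (Balance t))"
    by (subst sum.reindex) (auto simp: inj_on_def)
  also have "(\<Sum>c\<in>case_prod Line ` ({1..horizon D} \<times> parcs (network D)). multiplier c y * h c) =
      (\<Sum>t=1..horizon D. \<Sum>l\<in>parcs (network D). beta y t l * h (Line t l))"
    by (subst sum.reindex) (auto simp: inj_on_def sum.cartesian_product intro!: sum.cong)
  also have "(\<Sum>c\<in>case_prod Lower ` (UNIV \<times> {1..horizon D}). multiplier c y * h c) =
      (\<Sum>k\<in>UNIV. \<Sum>t=1..horizon D. nu y k t * h (Lower k t))"
    by (subst sum.reindex) (auto simp: inj_on_def sum.cartesian_product intro!: sum.cong)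
  also have "(\<Sum>c\<in>case_prod Upper ` (UNIV \<times> {1..horizon D}). multiplier c y * h c) =
      (\<Sum>k\<in>UNIV. \<Sum>t=1..horizon D. mu y k t * h (Upper k t))"
    by (subst sum.reindex) (auto simp: inj_on_def sum.cartesian_product intro!: sum.cong)
  finally show ?thesis
    by (simp add: sum.distrib sum_subtractf sum_negf)
qed

lemma lagrangian_eq:
  "lagrangian D (fst \<circ> x) (snd \<circ> x) y =
     total_cost D (fst \<circ> x) + (\<Sum>c\<in>constraints D. multiplier c y * violation c D x)"
  by (simp add: sum_constraints lagrangian_def total_cost_def sum.distrib sum_subtractf sum_negf)

lemma net_injection_step:
  fixes x d :: "nat \<Rightarrow> (real^'n::finite) \<times> (real^'k::finite)"
  shows "net_injection D (fst \<circ> (\<lambda>i. x i + s *\<^sub>R d i)) (snd \<circ> (\<lambda>i. x i + s *\<^sub>R d i)) t =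
    net_injection D (fst \<circ> x) (snd \<circ> x) t
    + s *\<^sub>R (net_injection D (fst \<circ> d) (snd \<circ> d) t - net_injection D (\<lambda>_. 0) (\<lambda>_. 0) t)"
  by (simp add: net_injection_def matrix_vector_right_distrib matrix_vector_mult_scaleR
      scaleR_diff_right)

lemma affine_form_violation: "affine_form (violation c D)"
proof (cases c)
  case (Balance t)
  show ?thesis
    unfolding affine_form_def Balance violation.simps net_injection_step
    by (simp add: comp_def sum.distrib sum_subtractf sum_distrib_left right_diff_distrib)
next
  case (Line t l)
  show ?thesis
    unfolding affine_form_def Line violation.simps flow_def net_injection_step
    by (simp add: comp_def inner_add_right inner_diff_right)
qed (simp_all add: affine_form_def soc_def sum.distrib sum_distrib_left algebra_simps)

lemma ball_constraints:
  "(\<forall>c\<in>constraints D. P c) \<longleftrightarrow>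
     (\<forall>t\<in>{1..horizon D}. P (Balance t)) \<and>
     (\<forall>t\<in>{1..horizon D}. \<forall>l\<in>parcs (network D). P (Line t l)) \<and>
     (\<forall>k. \<forall>t\<in>{1..horizon D}. P (Lower k t) \<and> P (Upper k t))"
  unfolding constraints_def ball_Un ball_simps split_paired_Ball_Sigma prod.case by blast

lemma primal_feasible_iff:
  "primal_feasible D (fst \<circ> x) (snd \<circ> x) \<longleftrightarrow>
     (\<forall>c\<in>constraints D. violation c D x \<le> 0 \<and> (c \<in> range Balance \<longrightarrow> violation c D x = 0))"
  unfolding primal_feasible_def ball_constraints by (auto simp: image_iff)

lemma dual_feasible_iff:
  "dual_feasible D y \<longleftrightarrow> (\<forall>c\<in>constraints D. c \<notin> range Balance \<longrightarrow> 0 \<le> multiplier c y)"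
  unfolding dual_feasible_def ball_constraints by (auto simp: image_iff)

context radial_dispatch
begin

text \<open>Strong duality with an attained dual: the multipliers at the primal optimum are
  repackaged as dual variables.\<close>

lemma dual_attains_cost:
  assumes opt: "primal_optimal D g u"
  shows "\<exists>y. dual_feasible D y \<and> ereal (total_cost D g) \<le> dual_function D y"
proof -
  define x0 where "x0 t = (g t, u t)" for t
  have x0: "fst \<circ> x0 = g" "snd \<circ> x0 = u"
    by (simp_all add: x0_def fun_eq_iff)
  obtain a b c where quad: "\<And>v. a v > 0" "\<And>v x. gen_cost D v x = a v * x\<^sup>2 + b v * x + c v"
    using strictly_convex_quadratic by metis
  define J where "J x = total_cost D (fst \<circ> x)" for x :: "nat \<Rightarrow> (real^'n) \<times> (real^'k)"
  \<comment> \<open>\<open>B\<close> and \<open>Q\<close> are the first- and second-order terms of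
    the exact expansion of the cost around \<open>g\<close>.\<close>
  define B where "B d = (\<Sum>t=1..horizon D. \<Sum>v\<in>UNIV. (2 * a v * g t $ v + b v) * fst (d t) $ v)"
    for d :: "nat \<Rightarrow> (real^'n) \<times> (real^'k)"
  define Q where "Q d = (\<Sum>t=1..horizon D. \<Sum>v\<in>UNIV. a v * (fst (d t) $ v)\<^sup>2)"
    for d :: "nat \<Rightarrow> (real^'n) \<times> (real^'k)"
  have "\<exists>l. (\<forall>c\<in>constraints D - range Balance. 0 \<le> l c) \<and>
      (\<forall>x. J x0 \<le> J x + (\<Sum>c\<in>constraints D. l c * violation c D x))"
  proof (rule lagrange_multipliers[OF finite_constraints affine_form_violation])
    show "linear_form B"
      by (simp add: linear_form_def B_def sum.distrib sum_distrib_left algebra_simps)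
    show "Q d \<ge> 0" for d
      using quad(1) by (auto simp: Q_def less_imp_le intro!: sum_nonneg mult_nonneg_nonneg)
    show "J (\<lambda>i. x0 i + s *\<^sub>R d i) = J x0 + s * B d + s\<^sup>2 * Q d" for d s
      by (simp add: J_def B_def Q_def total_cost_def quad(2) x0_def sum_distrib_left
          power2_eq_square algebra_simps flip: sum.distrib)
    show "violation c D x0 \<le> 0 \<and> (c \<in> range Balance \<longrightarrow> violation c D x0 = 0)"
      if "c \<in> constraints D" for c
      using opt that primal_feasible_iff[of D x0] by (auto simp: primal_optimal_def x0)
    show "J x0 \<le> J x"
      if "\<forall>c\<in>constraints D. violation c D x \<le> 0 \<and> (c \<in> range Balance \<longrightarrow> violation c D x = 0)" for x
      using opt that primal_feasible_iff[of D x] by (auto simp: primal_optimal_def J_def x0)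
  qed
  then obtain l where l: "\<forall>c\<in>constraints D - range Balance. 0 \<le> l c"
      "\<And>x. J x0 \<le> J x + (\<Sum>c\<in>constraints D. l c * violation c D x)"
    by blast
  define y :: "('n, 'k) dual_vars" where
    "y = \<lparr>gamma = \<lambda>t. - l (Balance t), beta = \<lambda>t e. l (Line t e),
          nu = \<lambda>k t. l (Lower k t), mu = \<lambda>k t. l (Upper k t)\<rparr>"
  have y: "multiplier c y = l c" for c
    by (cases c) (simp_all add: y_def)
  have "total_cost D g \<le> lagrangian D g' u' y" for g' u'
    using l(2)[of "\<lambda>t. (g' t, u' t)"] lagrangian_eq[of D "\<lambda>t. (g' t, u' t)" y]
    by (simp add: y J_def x0_def comp_def)
  then have "ereal (total_cost D g) \<le> dual_function D y"
    by (auto simp: dual_function_def intro!: INF_greatest)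
  moreover have "dual_feasible D y"
    using l(1) by (simp add: dual_feasible_iff y)
  ultimately show ?thesis by blast
qed

end

section \<open>Optimality conditions and differences of locational prices\<close>

locale optimal_dispatch = radial_dispatch D
  for D :: "('n::finite, 'k::finite) dispatch" +
  fixes g :: "nat \<Rightarrow> real^'n" and u :: "nat \<Rightarrow> real^'k" and y :: "('n, 'k) dual_vars"
  assumes primal_optimal: "primal_optimal D g u" and dual_optimal: "dual_optimal D y"
begin

text \<open>The bound passes from the constructed multipliers to the given \<open>y\<close>, whose
  dual value is at least as large.\<close>

lemma cost_le_lagrangian: "total_cost D g \<le> lagrangian D g' u' y"
proof -
  obtain y0 where "dual_feasible D y0" "ereal (total_cost D g) \<le> dual_function D y0"
    using dual_attains_cost[OF primal_optimal] by blast
  then have "ereal (total_cost D g) \<le> dual_function D y"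
    using dual_optimal by (auto simp: dual_optimal_def intro: order_trans)
  also have "\<dots> \<le> ereal (lagrangian D g' u' y)"
    unfolding dual_function_def by (rule INF_lower2[of "(g', u')"]) auto
  finally show ?thesis by simp
qed

definition plan :: "nat \<Rightarrow> (real^'n) \<times> (real^'k)" where
  "plan t = (g t, u t)"

lemma plan [simp]: "fst \<circ> plan = g" "snd \<circ> plan = u"
  by (simp_all add: plan_def fun_eq_iff)

text \<open>Feasibility makes each product nonpositive, while the Lagrangian bound at
  \<open>(g, u)\<close> makes their sum nonnegative.\<close>

lemma complementary_slackness:
  assumes "c \<in> constraints D"
  shows "multiplier c y * violation c D plan = 0"
proof -
  have le: "multiplier c y * violation c D plan \<le> 0" if "c \<in> constraints D" for c
  proof (cases "c \<in> range Balance")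
    case True
    then show ?thesis
      using that primal_optimal primal_feasible_iff[of D plan] by (auto simp: primal_optimal_def)
  next
    case False
    then show ?thesis
      using that primal_optimal primal_feasible_iff[of D plan] dual_optimal
      by (auto simp: primal_optimal_def dual_optimal_def dual_feasible_iff mult_nonneg_nonpos)
  qed
  have "0 \<le> (\<Sum>c\<in>constraints D. multiplier c y * violation c D plan)"
    using cost_le_lagrangian[of g u] lagrangian_eq[of D plan y] by simp
  moreover have "(\<Sum>c\<in>constraints D. multiplier c y * violation c D plan) \<le> 0"
    using le by (rule sum_nonpos)
  ultimately have "(\<Sum>c\<in>constraints D. - (multiplier c y * violation c D plan)) = 0"
    by (simp add: sum_negf)
  moreover have "(\<Sum>c\<in>constraints D. - (multiplier c y * violation c D plan)) = 0 \<longleftrightarrow>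
      (\<forall>c\<in>constraints D. - (multiplier c y * violation c D plan) = 0)"
    using le by (intro sum_nonneg_eq_0_iff finite_constraints) simp
  ultimately show ?thesis
    using assms by (simp del: mult_eq_0_iff)
qed

text \<open>With generation fixed, the Lagrangian is affine along \<open>d\<close> and minimal at
  \<open>plan\<close>, so its slope vanishes.\<close>

lemma stationarity:
  assumes "\<And>t. fst (d t) = 0"
  shows "(\<Sum>c\<in>constraints D. multiplier c y * (violation c D d - violation c D (\<lambda>_. 0))) = 0"
    (is "?S = 0")
proof -
  have "0 \<le> s * ?S" for s
  proof -
    let ?x = "\<lambda>i. plan i + s *\<^sub>R d i"
    have "fst \<circ> ?x = g"
      using assms by (simp add: plan_def fun_eq_iff)
    then have "total_cost D g \<le> total_cost D g + (\<Sum>c\<in>constraints D. multiplier c y * violation c D ?x)"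
      using cost_le_lagrangian[of "fst \<circ> ?x" "snd \<circ> ?x"] lagrangian_eq[of D ?x y] by simp
    also have "(\<Sum>c\<in>constraints D. multiplier c y * violation c D ?x) =
        (\<Sum>c\<in>constraints D. multiplier c y * violation c D plan) + s * ?S"
      by (simp only: affine_form_step[OF affine_form_violation])
        (simp add: sum.distrib sum_subtractf sum_distrib_left algebra_simps)
    also have "(\<Sum>c\<in>constraints D. multiplier c y * violation c D plan) = 0"
      by (intro sum.neutral ballI complementary_slackness)
    finally show ?thesis by simp
  qed
  from this[of 1] this[of "-1"] show ?thesis by simp
qed

text \<open>Charging unit \<open>k\<close> by one more unit of energy in period \<open>t\<close> and one less in period \<open>t + 1\<close>
  changes only the state of charge at the end of period \<open>t\<close>.\<close>

lemma lmp_storage: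
  assumes t: "t \<in> {1..horizon D - 1}"
  shows "lmp D y (t + 1) $ unit_bus D k (t + 1) - lmp D y t $ unit_bus D k t = mu y k t - nu y k t"
proof -
  have periods: "1 \<le> t" "t \<le> horizon D" "t + 1 \<le> horizon D"
    using t by auto
  define w where "w \<tau> = (if \<tau> = t then 1 else if \<tau> = t + 1 then - 1 else 0 :: real)" for \<tau>
  define d :: "nat \<Rightarrow> (real^'n) \<times> (real^'k)" where "d \<tau> = (0, w \<tau> *\<^sub>R axis k 1)" for \<tau>
  \<comment> \<open>The slope of each constraint along \<open>d\<close>; the following facts compute
    it for the four families.\<close>
  define h where "h c = violation c D d - violation c D (\<lambda>_. 0)" for c
  have inj: "net_injection D (fst \<circ> d) (snd \<circ> d) \<tau> -
      net_injection D (\<lambda>_. 0) (\<lambda>_. 0) \<tau> = - w \<tau> *\<^sub>R axis (unit_bus D k \<tau>) 1" for \<tau>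
  proof -
    have "unit_matrix D \<tau> *v axis k 1 = axis (unit_bus D k \<tau>) 1"
      by (simp add: matrix_vector_mult_basis unit_matrix_def column_def vec_eq_iff)
    then show ?thesis
      by (simp add: net_injection_def d_def matrix_vector_mult_scaleR)
  qed
  have "h (Balance \<tau>) = (\<Sum>v\<in>UNIV. (- w \<tau> *\<^sub>R axis (unit_bus D k \<tau>) (1::real)) $ v)" for \<tau>
    unfolding inj[symmetric] by (simp add: h_def comp_def sum_subtractf)
  then have balance: "h (Balance \<tau>) = - w \<tau>" for \<tau>
    by (simp add: axis_def sum_negf if_distrib cong: if_cong)
  have "h (Line \<tau> l) = shift_factor D l \<bullet> (- w \<tau> *\<^sub>R axis (unit_bus D k \<tau>) 1)" for \<tau> l
    unfolding inj[symmetric] by (simp add: h_def flow_def comp_def inner_diff_right)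
  then have line: "h (Line \<tau> l) = - w \<tau> * shift_factor D l $ unit_bus D k \<tau>" for \<tau> l
    by (simp add: inner_axis)
  \<comment> \<open>The charge in period \<open>t\<close> is undone in period \<open>t + 1\<close>;
    \<open>t \<ge> 1\<close> ensures that the sum includes it.\<close>
  have "(\<Sum>i=1..\<tau>. w i) = (if \<tau> = t then 1 else 0)" for \<tau>
  proof -
    have "(\<Sum>i=1..\<tau>. w i) = (\<Sum>i=1..\<tau>. (if i = t then 1 else 0) - (if i = t + 1 then 1 else 0))"
      by (intro sum.cong) (auto simp: w_def)
    then show ?thesis
      using t by (auto simp: sum_subtractf)
  qed
  then have soc: "h (Upper k' \<tau>) = (if k' = k \<and> \<tau> = t then 1 else 0)"
      "h (Lower k' \<tau>) = - (if k' = k \<and> \<tau> = t then 1 else 0)" for k' \<tau>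
    by (auto simp: h_def soc_def d_def axis_def)
  have "0 = (\<Sum>c\<in>constraints D. multiplier c y * h c)"
    using stationarity[of d] by (simp add: h_def d_def)
  \<comment> \<open>Balance and line terms combine to the price at the bus of the unit, the storage
    terms to \<open>mu - nu\<close>.\<close>
  also have "\<dots> = (\<Sum>\<tau>=1..horizon D. w \<tau> * lmp D y \<tau> $ unit_bus D k \<tau>)
      + (\<Sum>k'\<in>UNIV. \<Sum>\<tau>=1..horizon D. if k' = k then if \<tau> = t then mu y k t - nu y k t else 0 else 0)"
    unfolding sum_constraints balance line soc
    by (intro arg_cong2[of _ _ _ _ "(+)"] sum.cong)
      (auto simp: lmp_def sum_distrib_left sum_negf algebra_simps)
  also have "(\<Sum>\<tau>=1..horizon D. w \<tau> * lmp D y \<tau> $ unit_bus D k \<tau>) =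
      (\<Sum>\<tau>=1..horizon D. (if \<tau> = t then lmp D y \<tau> $ unit_bus D k \<tau> else 0)
        - (if \<tau> = t + 1 then lmp D y \<tau> $ unit_bus D k \<tau> else 0))"
    by (intro sum.cong) (auto simp: w_def)
  also have "\<dots> = lmp D y t $ unit_bus D k t - lmp D y (t + 1) $ unit_bus D k (t + 1)"
    using periods by (simp add: sum_subtractf)
  also have "(\<Sum>k'\<in>UNIV. \<Sum>\<tau>=1..horizon D. if k' = k then if \<tau> = t then mu y k t - nu y k t else 0 else 0)
      = mu y k t - nu y k t"
    using periods by (subst sum.swap) simp
  finally show ?thesis by simp
qed

text \<open>Only the two directions of the line contribute to the price difference. The reverse flow
  is negative, hence strictly below its nonnegative capacity, so its multiplier is 0.\<close>

lemma lmp_line: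
  assumes t: "t \<in> {1..horizon D}" and arc: "(a, b) \<in> parcs (network D)"
    and pos: "flow D g u t (a, b) > 0"
  shows "lmp D y t $ b - lmp D y t $ a = beta y t (a, b)"
proof -
  have sym: "(b, a) \<in> parcs (network D)"
    using radial arc by (rule radial_symmetric)
  have "shift_factor D (b, a) = - shift_factor D (a, b)"
    using shift_factors arc unfolding shift_factors_def by blast
  then have "flow D g u t (b, a) = - flow D g u t (a, b)"
    by (simp add: flow_def)
  then have "flow D g u t (b, a) - line_cap D (b, a) < 0"
    using pos line_cap_nonneg[OF sym] by linarith
  then have beta0: "beta y t (b, a) = 0"
    using complementary_slackness[of "Line t (b, a)"] t sym by simp
  have "lmp D y t $ b - lmp D y t $ a =
      (\<Sum>l\<in>parcs (network D). beta y t l * (shift_factor D l $ a - shift_factor D l $ b))"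
    by (simp add: lmp_def sum_subtractf algebra_simps)
  also have "\<dots> = (\<Sum>l\<in>parcs (network D).
      beta y t l * of_bool (l = (a, b)) - beta y t l * of_bool (l = (b, a)))"
    by (intro sum.cong)
      (simp_all only: shift_factors_adjacent[OF radial shift_factors arc] right_diff_distrib)
  also have "\<dots> = beta y t (a, b)"
    using arc sym beta0 by (simp add: sum_subtractf sum_mult_of_bool_eq)
  finally show ?thesis .
qed

text \<open>The price differences telescope along the walk; a walk with a single vertex gives 0 on
  both sides.\<close>

lemma lmp_path:
  assumes "t \<in> {1..horizon D}" "p \<noteq> []" "set (vwalk_arcs p) \<subseteq> parcs (network D)"
    and "\<forall>l\<in>set (vwalk_arcs p). flow D g u t l > 0"
  shows "lmp D y t $ last p - lmp D y t $ hd p = (\<Sum>l\<leftarrow>vwalk_arcs p. beta y t l)"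
  using assms
proof (induction p rule: vwalk_arcs.induct)
  case (3 a b p)
  then show ?case
    using lmp_line[of t a b] by simp
qed simp_all

end

theorem lemma1:
  fixes D :: "('n::finite, 'k::finite) dispatch"
    and g :: "nat \<Rightarrow> real^'n" and u :: "nat \<Rightarrow> real^'k"
    and y :: "('n, 'k) dual_vars"
    and t :: nat and i j :: 'n and path :: "'n list"
  assumes "radial_dispatch D"
    and "primal_optimal D g u"
    and "dual_optimal D y"
    and "t \<in> {1..horizon D - 1}"
    and "vpath path (with_proj (network D))" and "hd path = i" and "last path = j"
    and "\<forall>l \<in> set (vwalk_arcs path). flow D g u t l > 0"
    and "\<exists>k. stationary_at D k j \<and> soc u k t > 0"
  shows "mv_mobile D y i j t =
    (\<Sum>l\<leftarrow>vwalk_arcs path. mv_wire y l t) + mv_stationary D y j t"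
proof -
  interpret optimal_dispatch D g u y
    using assms by (simp add: optimal_dispatch_def optimal_dispatch_axioms_def)
  have t: "t \<in> {1..horizon D}" "t + 1 \<in> {1..horizon D}"
    using assms(4) by auto
  obtain k where k: "stationary_at D k j" "soc u k t > 0"
    using assms(9) by blast
  have "nu y k t = 0"
    using complementary_slackness[of "Lower k t"] t k by simp
  moreover have "mu y k t \<ge> 0"
    using dual_optimal t by (simp add: dual_optimal_def dual_feasible_def)
  \<comment> \<open>Stationarity of unit \<open>k\<close> puts it at \<open>j\<close> in both
    periods.\<close>
  ultimately have storage: "lmp D y (t + 1) $ j - lmp D y t $ j \<ge> 0"
    using lmp_storage[OF assms(4), of k] k t by (simp add: stationary_at_def)
  have arcs: "path \<noteq> []" "set (vwalk_arcs path) \<subseteq> parcs (network D)"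
    using assms(5) by (auto simp: vpath_def vwalk_def)
  have wires: "lmp D y t $ j - lmp D y t $ i = (\<Sum>l\<leftarrow>vwalk_arcs path. beta y t l)"
    using lmp_path[OF t(1) arcs assms(8)] assms(6,7) by simp
  have "0 \<le> (\<Sum>l\<leftarrow>vwalk_arcs path. beta y t l)"
    using dual_optimal t arcs by (intro sum_list_nonneg) (auto simp: dual_optimal_def dual_feasible_def)
  \<comment> \<open>The mobile price spread is the wire sum plus the storage spread, and both are
    nonnegative, so each \<open>max\<close> equals its first argument.\<close>
  with storage wires show ?thesis
    by (simp add: mv_mobile_def mv_stationary_def mv_wire_def)
qed

end
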